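(* Let $s,t\ge 1$ be coprime integers. Then $$\frac{\sum_{\lambda\in \mathcal{D}_s\cap \mathcal{D}_t} |\lambda|}{\sum_{\lambda\in \mathcal{D}_s\cap \mathcal{D}_t} 1} = \frac{1}{24}(s-1)(t-1)(s+t+1),$$ where the (finite) sums run over all self-conjugate partitions that are simultaneously $s$-cores and $t$-cores.
   Context: A partition is an infinite weakly decreasing sequence $\lambda=(\lambda_1,\lambda_2,\ldots)$ of nonnegative integers with finite size $|\lambda|=\lambda_1+\lambda_2+\cdots$. Its Young diagram is $[\lambda]=\{(r,c)\in\mathbb{Z}_{>0}^2 : c\le\lambda_r\}$, and its conjugate $\overline{\lambda}$ is defined by $\overline{\lambda}_r=\#\{c\in\mathbb{Z}_{>0}: r\le\lambda_c\}$; $\lambda$ is self-conjugate if $\lambda=\overline{\lambda}$. The hook length at $(r,c)\in[\lambda]$ is $1+(\lambda_r-r)+(\overline{\lambda}_c-c)$. For $s\ge1$, a partition is an $s$-core if it has no hook of length $s$; $\mathcal{C}_s$ denotes the set of $s$-cores and $\mathcal{D}_s\subseteq\mathcal{C}_s$ the set of self-conjugate $s$-cores. For coprime $s,t\ge 1$ the set $\mathcal{C}_s\cap\mathcal{C}_t$ is finite. *)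

theory Defs
  imports Complex_Main
begin

text \<open>
  Rows, columns and parts are indexed from \<open>0\<close>: the sequence \<open>p\<close> stands for the partition whose
  part number \<open>i + 1\<close> is \<open>p i\<close>, and the cell \<open>(i, j)\<close> stands for the cell
  \<open>(i + 1, j + 1)\<close> of the usual convention.
\<close>

definition is_partition :: "(nat \<Rightarrow> nat) \<Rightarrow> bool" where
  "is_partition p \<longleftrightarrow> decseq p \<and> summable p"

definition partition_size :: "(nat \<Rightarrow> nat) \<Rightarrow> nat" where
  "partition_size p = (\<Sum>i. p i)"

definition young_diagram :: "(nat \<Rightarrow> nat) \<Rightarrow> (nat \<times> nat) set" where
  "young_diagram p = {(i, j). Suc j \<le> p i}"

definition conjugate_partition :: "(nat \<Rightarrow> nat) \<Rightarrow> nat \<Rightarrow> nat" where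
  "conjugate_partition p j = card {i. Suc j \<le> p i}"

definition self_conjugate :: "(nat \<Rightarrow> nat) \<Rightarrow> bool" where
  "self_conjugate p \<longleftrightarrow> p = conjugate_partition p"

text \<open>The differences may be negative, hence the integers; the value on cells is positive.\<close>

definition hook_length :: "(nat \<Rightarrow> nat) \<Rightarrow> nat \<times> nat \<Rightarrow> int" where
  "hook_length p = (\<lambda>(i, j). 1 + (int (p i) - int (Suc i))
                              + (int (conjugate_partition p j) - int (Suc j)))"

definition cores :: "nat \<Rightarrow> (nat \<Rightarrow> nat) set" where
  "cores s = {p. is_partition p \<and> (\<forall>x \<in> young_diagram p. hook_length p x \<noteq> int s)}"

definition self_conjugate_cores :: "nat \<Rightarrow> (nat \<Rightarrow> nat) set" where
  "self_conjugate_cores s = {p \<in> cores s. self_conjugate p}"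

lemma summable_nat_iff_finite_support:
  fixes p :: "nat \<Rightarrow> nat"
  shows "summable p \<longleftrightarrow> finite {i. p i \<noteq> 0}"
proof
  assume "summable p"
  then obtain l where "(\<lambda>n. \<Sum>i<n. p i) \<longlonglongrightarrow> l"
    unfolding summable_def sums_def by blast
  then have "\<forall>\<^sub>F n in sequentially. (\<Sum>i<n. p i) = l"
    unfolding tendsto_discrete .
  then obtain N where N: "\<And>n. n \<ge> N \<Longrightarrow> (\<Sum>i<n. p i) = l"
    unfolding eventually_sequentially by blast
  have "p n = 0" if "n \<ge> N" for n
    using N[OF that] N[of "Suc n"] that by simp
  then have "{i. p i \<noteq> 0} \<subseteq> {..<N}"
    using not_less by blast
  then show "finite {i. p i \<noteq> 0}"
    by (rule finite_subset) simp
next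
  assume "finite {i. p i \<noteq> 0}"
  then show "summable p"
    by (rule summable_finite) simp
qed

lemma partition_size_eq_sum:
  assumes "is_partition p"
  shows "partition_size p = (\<Sum>i | p i \<noteq> 0. p i)"
proof -
  have "finite {i. p i \<noteq> 0}"
    using assms unfolding is_partition_def summable_nat_iff_finite_support by blast
  then show ?thesis
    unfolding partition_size_def by (rule suminf_finite) simp
qed

end

theory Submission
  imports Defs "HOL-Library.Infinite_Set"
begin

text \<open>
  Record a partition by its beads \<open>p i - i - 1\<close>. Hook lengths are the positive differences between a
  bead and a non-bead, so \<open>s\<close>-cores are the bead sets closed under subtracting \<open>s\<close>, and
  self-conjugacy means that \<open>x\<close> is a bead iff \<open>- 1 - x\<close> is not.

  One of the two coprime numbers is odd, say \<open>s = 2 * m + 1\<close>. Every integer is uniquely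
  \<open>s * k - t * j\<close> with \<open>\<bar>j\<bar> \<le> m\<close>, and after the shift by \<open>m + 1\<close> the largest bead of the class of
  \<open>- t * j\<close> modulo \<open>s\<close> is \<open>s * Z j - t * j\<close>, where \<open>Z\<close> is odd and weakly increasing with
  \<open>2 * Z m \<le> t\<close>. Thus self-conjugate simultaneous cores correspond to the sequences
  \<open>0 \<le> Z 1 \<le> \<dots> \<le> Z m \<le> t div 2\<close>, and \<open>s\<close> times the size is the sum of
  \<open>(s * Z j - t * j)\<^sup>2 - j\<^sup>2\<close> over \<open>1 \<le> j \<le> m\<close>. It remains to average \<open>(Z j)\<^sup>2\<close> and \<open>j * Z j\<close>
  over all such sequences, which only takes Pascal's recursion.
\<close>

section \<open>Beads of a partition\<close>

definition bead :: "(nat \<Rightarrow> nat) \<Rightarrow> nat \<Rightarrow> int" where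
  "bead p i = int (p i) - int i - 1"

text \<open>This is \<open>- 1 - bead (conjugate_partition p) j\<close>. By \<open>range_gap\<close>
  below, these numbers are exactly the non-beads.\<close>

definition gap :: "(nat \<Rightarrow> nat) \<Rightarrow> nat \<Rightarrow> int" where
  "gap p j = int j - int (conjugate_partition p j)"

definition beads :: "(nat \<Rightarrow> nat) \<Rightarrow> int set" where
  "beads p = range (bead p)"

text \<open>The symmetry also fixes the charge: it pairs the members \<open>x >= 0\<close> with the
  non-members \<open>x < 0\<close>.\<close>

definition balanced :: "int set \<Rightarrow> bool" where
  "balanced S \<longleftrightarrow> (\<forall>x. x \<in> S \<longleftrightarrow> - 1 - x \<notin> S)"

lemma is_partition_eventually_zero:
  assumes "is_partition p"
  obtains N where "\<And>i. i \<ge> N \<Longrightarrow> p i = 0"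
proof -
  have "finite {i. p i \<noteq> 0}"
    using assms unfolding is_partition_def summable_nat_iff_finite_support by blast
  then obtain N where "\<forall>i\<in>{i. p i \<noteq> 0}. i < N"
    using finite_nat_set_iff_bounded by blast
  then show ?thesis by (intro that[of N]) fastforce
qed

text \<open>Parts decrease, so the rows meeting column \<open>j\<close> form an initial segment,
  ending before the first row with \<open>p i \<le> j\<close>.\<close>

lemma less_conjugate_partition_iff:
  assumes "is_partition p"
  shows "i < conjugate_partition p j \<longleftrightarrow> j < p i"
proof -
  obtain N where N: "\<And>i. i \<ge> N \<Longrightarrow> p i = 0"
    using is_partition_eventually_zero[OF assms] by blast
  have dec: "p b \<le> p a" if "a \<le> b" for a b
    using assms that unfolding is_partition_def decseq_def by blast
  define k where "k = (LEAST i. p i \<le> j)"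
  have k: "p k \<le> j"
    unfolding k_def by (rule LeastI[of "\<lambda>i. p i \<le> j" N]) (simp add: N)
  have "{i. Suc j \<le> p i} = {..<k}"
  proof (intro set_eqI iffI)
    fix i assume "i \<in> {i. Suc j \<le> p i}"
    then show "i \<in> {..<k}" using dec[of k i] k by (cases "k \<le> i") auto
  next
    fix i assume "i \<in> {..<k}"
    then show "i \<in> {i. Suc j \<le> p i}" using not_less_Least[of i "\<lambda>i. p i \<le> j"] k_def by auto
  qed
  then show ?thesis
    unfolding conjugate_partition_def
    by (metis (no_types, lifting) Suc_le_eq card_lessThan lessThan_iff mem_Collect_eq)
qed

lemma bead_strict_antimono:
  assumes "is_partition p" "i < j"
  shows "bead p j < bead p i"
proof -
  have "p j \<le> p i"
    using assms unfolding is_partition_def decseq_def by auto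
  then show ?thesis using assms(2) unfolding bead_def by simp
qed

lemma hook_length_eq: "hook_length p (i, j) = bead p i - gap p j"
  unfolding hook_length_def bead_def gap_def by simp

lemma gap_less_bead_iff:
  assumes "is_partition p"
  shows "gap p j < bead p i \<longleftrightarrow> (i, j) \<in> young_diagram p"
  using less_conjugate_partition_iff[OF assms, of i j]
  unfolding gap_def bead_def young_diagram_def by auto

lemma gap_neq_bead:
  assumes "is_partition p"
  shows "gap p j \<noteq> bead p i"
  using less_conjugate_partition_iff[OF assms, of i j]
  unfolding gap_def bead_def by auto

text \<open>If \<open>i\<close> is the first index whose bead is below a non-bead \<open>x\<close>,
  then column \<open>x + i\<close> has height exactly \<open>i\<close>, so its gap is
  \<open>x\<close>.\<close>

lemma range_gap:
  assumes "is_partition p"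
  shows "range (gap p) = - beads p"
proof (intro set_eqI iffI)
  fix x assume "x \<in> range (gap p)"
  then show "x \<in> - beads p"
    using gap_neq_bead[OF assms] unfolding beads_def by auto
next
  fix x assume x: "x \<in> - beads p"
  obtain N where N: "\<And>i. i \<ge> N \<Longrightarrow> p i = 0"
    using is_partition_eventually_zero[OF assms] by blast
  define i where "i = (LEAST i. bead p i \<le> x)"
  \<comment> \<open>Past the support, bead \<open>i\<close> equals \<open>- i - 1\<close>, so
    \<open>nat (- x)\<close> further rows suffice.\<close>
  have "bead p (N + nat (- x)) \<le> x"
    using N[of "N + nat (- x)"] unfolding bead_def by auto
  then have le: "bead p i \<le> x"
    unfolding i_def by (rule LeastI)
  moreover have "bead p i \<noteq> x"
    using x unfolding beads_def by auto
  ultimately have lt: "bead p i < x" by simp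
  then have nonneg: "int (p i) \<le> x + int i"
    unfolding bead_def by simp
  define j where "j = nat (x + int i)"
  have j: "int j = x + int i" using nonneg unfolding j_def by simp
  have "\<not> i < conjugate_partition p j"
    using nonneg j unfolding less_conjugate_partition_iff[OF assms] by simp
  moreover have "\<not> conjugate_partition p j < i"
  proof
    assume less: "conjugate_partition p j < i"
    have "x < bead p (i - 1)"
      using not_less_Least[of "i - 1" "\<lambda>i. bead p i \<le> x"] less unfolding i_def by force
    then have "j < p (i - 1)"
      using less j unfolding bead_def by simp
    then have "i - 1 < conjugate_partition p j"
      unfolding less_conjugate_partition_iff[OF assms] .
    then show False using less by simp
  qed
  ultimately have "gap p j = x" using j unfolding gap_def by simp
  then show "x \<in> range (gap p)" by blast
qed

text \<open>Hook lengths are differences bead minus gap. As \<open>s\<close> is positive, a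
  difference equal to \<open>s\<close> always comes from a cell.\<close>

lemma cores_iff_beads:
  assumes "is_partition p" "s \<ge> 1"
  shows "p \<in> cores s \<longleftrightarrow> (\<forall>x\<in>beads p. x - int s \<in> beads p)"
proof -
  have "p \<in> cores s \<longleftrightarrow> (\<forall>i j. bead p i - gap p j \<noteq> int s)"
    using assms gap_less_bead_iff[OF assms(1)] unfolding cores_def
    by (force simp: hook_length_eq)
  also have "\<dots> \<longleftrightarrow> (\<forall>i. bead p i - int s \<notin> range (gap p))"
  proof -
    have "bead p i - gap p j \<noteq> int s \<longleftrightarrow> bead p i - int s \<noteq> gap p j" for i j by auto
    then show ?thesis by blast
  qed
  also have "\<dots> \<longleftrightarrow> (\<forall>x\<in>beads p. x - int s \<in> beads p)"
    unfolding range_gap[OF assms(1)] unfolding beads_def by auto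
  finally show ?thesis .
qed

text \<open>The value at \<open>n\<close> is the smallest element of the range not listed
  before.\<close>

lemma strict_mono_eqI:
  fixes f g :: "nat \<Rightarrow> int"
  assumes f: "strict_mono f" and g: "strict_mono g" and r: "range f = range g"
  shows "f = g"
proof
  fix n show "f n = g n"
  proof (induction n rule: less_induct)
    case (less n)
    \<comment> \<open>Stated for arbitrary \<open>u\<close> and \<open>v\<close>, so that exchanging
      \<open>f\<close> and \<open>g\<close> gives both inequalities.\<close>
    have *: "v n \<le> u n" if u: "strict_mono u" and v: "strict_mono v" and "range u = range v"
      and eq: "\<And>k. k < n \<Longrightarrow> u k = v k" for u v :: "nat \<Rightarrow> int"
    proof -
      obtain k where k: "u n = v k" using \<open>range u = range v\<close> by blast
      have "n \<le> k"
      proof (rule ccontr)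
        assume "\<not> n \<le> k"
        then have "u k = u n" using eq[of k] k by simp
        then show False using strict_mono_eq[OF u] \<open>\<not> n \<le> k\<close> by simp
      qed
      then show ?thesis using k strict_mono_less_eq[OF v] by simp
    qed
    show ?case
      using *[OF f g r] *[OF g f r[symmetric]] less by (metis order_antisym)
  qed
qed

lemma strict_mono_uminus_bead:
  assumes "is_partition p"
  shows "strict_mono (\<lambda>i. - 1 - bead p i)"
  using bead_strict_antimono[OF assms] by (auto intro!: strict_monoI)

lemma strict_mono_gap:
  assumes "is_partition p"
  shows "strict_mono (gap p)"
proof (rule strict_monoI)
  fix i j :: nat assume "i < j"
  have "conjugate_partition p j \<le> conjugate_partition p i"
    using less_conjugate_partition_iff[OF assms] \<open>i < j\<close>
    by (meson leI less_irrefl less_trans)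
  then show "gap p i < gap p j" using \<open>i < j\<close> unfolding gap_def by simp
qed

lemma beads_inject:
  assumes "is_partition p" "is_partition q" "beads p = beads q"
  shows "p = q"
proof -
  have "range (\<lambda>i. - 1 - bead p i) = range (\<lambda>i. - 1 - bead q i)"
    using assms(3) unfolding beads_def by (metis image_image)
  then have "(\<lambda>i. - 1 - bead p i) = (\<lambda>i. - 1 - bead q i)"
    using strict_mono_eqI strict_mono_uminus_bead assms(1,2) by blast
  then have "bead p i = bead q i" for i by (meson diff_left_imp_eq)
  then show ?thesis unfolding bead_def by (intro ext) simp
qed

text \<open>Self-conjugacy equates \<open>gap p\<close> with the reflected beads as functions,
  balance equates their ranges; both are strictly increasing, so this is the same.\<close>

lemma self_conjugate_iff_balanced:
  assumes "is_partition p"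
  shows "self_conjugate p \<longleftrightarrow> balanced (beads p)"
proof -
  have mem: "x \<in> range (\<lambda>i. - 1 - bead p i) \<longleftrightarrow> - 1 - x \<in> beads p" for x
    unfolding beads_def by (auto simp: image_iff) (metis diff_diff_eq2 diff_add_cancel add.commute)+
  have "self_conjugate p \<longleftrightarrow> gap p = (\<lambda>i. - 1 - bead p i)"
    unfolding self_conjugate_def gap_def bead_def fun_eq_iff by auto
  also have "\<dots> \<longleftrightarrow> range (gap p) = range (\<lambda>i. - 1 - bead p i)"
    using strict_mono_eqI[OF strict_mono_gap[OF assms] strict_mono_uminus_bead[OF assms]] by auto
  also have "\<dots> \<longleftrightarrow> balanced (beads p)"
    unfolding range_gap[OF assms] balanced_def set_eq_iff mem by auto
  finally show ?thesis .
qed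

section \<open>From balanced sets of integers back to partitions\<close>

lemma beads_bounded_above:
  assumes "is_partition p"
  shows "bdd_above (beads p)"
proof -
  have "bead p i \<le> bead p 0" for i
    using bead_strict_antimono[OF assms, of 0 i] by (cases "i = 0") auto
  then show ?thesis unfolding beads_def by (rule bdd_aboveI2)
qed

text \<open>Listing \<open>S\<close> downwards gives the beads. Balance enters through a count which
  makes the recovered parts end in \<open>0\<close> rather than in another constant.\<close>

lemma balanced_obtain_partition:
  assumes bal: "balanced S" and bdd: "bdd_above S"
  obtains p where "is_partition p" "beads p = S"
proof -
  obtain b where b: "\<And>x. x \<in> S \<Longrightarrow> x \<le> b" using bdd unfolding bdd_above_def by blast
  define M where "M = nat b"
  have M: "x \<le> int M" if "x \<in> S" for x
    using b[OF that] unfolding M_def by simp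
  have low: "x \<in> S" if "x < - 1 - int M" for x
  proof -
    have "- 1 - x \<notin> S" using M[of "- 1 - x"] that by auto
    then show ?thesis using bal unfolding balanced_def by blast
  qed
  \<comment> \<open>Reading \<open>S\<close> downwards from \<open>M\<close> gives a set of
    naturals, to which \<open>enumerate\<close> applies.\<close>
  define T where "T = {k. int M - int k \<in> S}"
  have T: "k \<in> T" if "2 * M + 2 \<le> k" for k
    using low that unfolding T_def by auto
  have inf: "infinite T"
    unfolding infinite_nat_iff_unbounded_le using T le_add1 le_add2 by blast
  have mono: "strict_mono (enumerate T)" using strict_mono_enumerate[OF inf] .
  have range: "range (enumerate T) = T" using range_enumerate[OF inf] .
  have enum: "enumerate T (card {x\<in>T. x < k}) = k" if k: "k \<in> T" for k
  proof -
    have ex: "\<exists>n. k = enumerate T n" if "k \<in> T" for k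
    proof -
      have "k \<in> range (enumerate T)" using that unfolding range .
      then show ?thesis by blast
    qed
    obtain n where n: "k = enumerate T n" using ex[OF k] by blast
    have "{x\<in>T. x < k} = enumerate T ` {..<n}"
    proof (intro equalityI subsetI)
      fix x assume x: "x \<in> {x\<in>T. x < k}"
      then obtain i where i: "x = enumerate T i" using ex by blast
      then have "i < n" using x n strict_mono_less[OF mono] by simp
      then show "x \<in> enumerate T ` {..<n}" using i by blast
    next
      fix x assume "x \<in> enumerate T ` {..<n}"
      then show "x \<in> {x\<in>T. x < k}"
        using n strict_mono_less[OF mono] enumerate_in_set[OF inf] by auto
    qed
    then have "card {x\<in>T. x < k} = n"
      using strict_mono_imp_inj_on[OF mono] by (simp add: card_image inj_on_subset)
    then show ?thesis using n by simp
  qed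
  \<comment> \<open>On \<open>T\<close> the reflection becomes \<open>k\<close> to
    \<open>c - k\<close>, so exactly half of the \<open>2 * M + 2\<close> numbers up to
    \<open>c\<close> lie in \<open>T\<close>.\<close>
  define c where "c = 2 * M + 1"
  have half: "card {x\<in>T. x \<le> c} = M + 1"
  proof -
    have flip: "c - x \<in> T \<longleftrightarrow> x \<notin> T" if "x \<le> c" for x
    proof -
      have "int M - int (c - x) = - 1 - (int M - int x)" using that unfolding c_def by simp
      then have "c - x \<in> T \<longleftrightarrow> - 1 - (int M - int x) \<in> S"
        unfolding T_def mem_Collect_eq by (simp only:)
      also have "\<dots> \<longleftrightarrow> int M - int x \<notin> S"
        using bal unfolding balanced_def by blast
      finally show ?thesis unfolding T_def by simp
    qed
    have "bij_betw (\<lambda>x. c - x) {x\<in>T. x \<le> c} ({..c} - T)"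
      by (rule bij_betw_byWitness[where f' = "\<lambda>x. c - x"]) (auto simp: flip)
    then have "card {x\<in>T. x \<le> c} = card ({..c} - T)"
      by (rule bij_betw_same_card)
    moreover have "{..c} = {x\<in>T. x \<le> c} \<union> ({..c} - T)" by auto
    then have "card {..c} = card {x\<in>T. x \<le> c} + card ({..c} - T)"
      by (metis (no_types, lifting) Diff_disjoint card_Un_disjoint disjoint_iff finite_Un
          finite_atMost mem_Collect_eq DiffD2)
    ultimately show ?thesis unfolding c_def by simp
  qed
  \<comment> \<open>Solves \<open>a i - i - 1 = M - enumerate T i\<close>, which makes the right
    side bead number \<open>i\<close>.\<close>
  define a where "a i = int M - int (enumerate T i) + int i + 1" for i
  have a_dec: "a (Suc i) \<le> a i" for i
    using strict_monoD[OF mono, of i "Suc i"] unfolding a_def by simp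
  have a_zero: "a i = 0" if "M + 1 \<le> i" for i
  proof -
    \<comment> \<open>Everything beyond \<open>c\<close> lies in \<open>T\<close>, so the
      \<open>M + 1\<close> elements up to \<open>c\<close> put \<open>M + i + 1\<close> at index
      \<open>i\<close>.\<close>
    have split: "{x\<in>T. x < M + i + 1} = {x\<in>T. x \<le> c} \<union> {2 * M + 2..<M + i + 1}"
      using T that unfolding c_def by (auto simp: not_less_eq_eq)
    have "card {x\<in>T. x < M + i + 1} = i"
      unfolding split using that half by (subst card_Un_disjoint) (auto simp: c_def)
    moreover have "M + i + 1 \<in> T" using T that by simp
    ultimately have "enumerate T i = M + i + 1" using enum by metis
    then show ?thesis unfolding a_def by simp
  qed
  have "decseq a" using a_dec by (rule decseq_SucI)
  then have a_nonneg: "0 \<le> a i" for i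
    using a_zero[of "M + 1 + i"] unfolding decseq_def by (metis le_add1 le_add2)
  \<comment> \<open>By \<open>a_nonneg\<close>, \<open>nat\<close> loses nothing.\<close>
  define p where "p i = nat (a i)" for i
  have "is_partition p"
    unfolding is_partition_def summable_nat_iff_finite_support
  proof
    show "decseq p" using \<open>decseq a\<close> unfolding p_def decseq_def by (simp add: nat_mono)
    have "{i. p i \<noteq> 0} \<subseteq> {..M}"
      using a_zero unfolding p_def by (auto simp: not_le) (metis Suc_leI not_le order_refl less_irrefl)
    then show "finite {i. p i \<noteq> 0}" by (rule finite_subset) simp
  qed
  moreover have "beads p = S"
  proof -
    have "bead p i = int M - int (enumerate T i)" for i
      using a_nonneg[of i] unfolding bead_def p_def a_def by simp
    then have "beads p = (\<lambda>k. int M - int k) ` T"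
      unfolding beads_def by (metis (no_types, lifting) image_cong image_image range)
    also have "\<dots> = S"
    proof (intro set_eqI iffI)
      fix x assume "x \<in> S"
      then have "nat (int M - x) \<in> T" "x = int M - int (nat (int M - x))"
        using M unfolding T_def by auto
      then show "x \<in> (\<lambda>k. int M - int k) ` T" by blast
    qed (auto simp: T_def)
    finally show ?thesis .
  qed
  ultimately show ?thesis by (rule that)
qed

section \<open>The size in terms of beads\<close>

text \<open>The beads from \<open>- N\<close> upwards are exactly the first \<open>N\<close>. Row
  \<open>i\<close> satisfies \<open>2 * p i = (2 * bead p i + 1) + (2 * i + 1)\<close>, and the odd
  numbers sum to the square of \<open>N\<close>.\<close>

lemma partition_size_beads:
  assumes p: "is_partition p" and N: "\<And>i. i \<ge> N \<Longrightarrow> p i = 0"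
  shows "2 * int (partition_size p) = (\<Sum>x\<in>{x\<in>beads p. - int N \<le> x}. 2 * x + 1) + (int N)\<^sup>2"
proof -
  have "bead p ` {..<N} = {x\<in>beads p. - int N \<le> x}"
  proof (intro equalityI subsetI)
    fix x assume "x \<in> {x\<in>beads p. - int N \<le> x}"
    then obtain i where i: "x = bead p i" "- int N \<le> bead p i" unfolding beads_def by auto
    then have "i < N" using N[of i] by (cases "i < N") (auto simp: bead_def)
    then show "x \<in> bead p ` {..<N}" using i by blast
  qed (auto simp: beads_def bead_def)
  moreover have "inj_on (bead p) {..<N}"
    using bead_strict_antimono[OF p] by (intro inj_onI) (metis less_irrefl linorder_neqE_nat)
  ultimately have beads: "(\<Sum>x\<in>{x\<in>beads p. - int N \<le> x}. 2 * x + 1) = (\<Sum>i<N. 2 * bead p i + 1)"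
    by (metis (no_types, lifting) comp_apply sum.cong sum.reindex)
  have "partition_size p = (\<Sum>i<N. p i)"
    unfolding partition_size_eq_sum[OF p]
  proof (rule sum.mono_neutral_left)
    show "{i. p i \<noteq> 0} \<subseteq> {..<N}" 
    proof
      fix i assume "i \<in> {i. p i \<noteq> 0}"
      then have "\<not> N \<le> i" using N by auto
      then show "i \<in> {..<N}" by simp
    qed
  qed auto
  then have "2 * int (partition_size p) = (\<Sum>i<N. 2 * int (p i))"
    by (simp add: sum_distrib_left)
  also have "\<dots> = (\<Sum>i<N. (2 * bead p i + 1) + (2 * int i + 1))"
    by (intro sum.cong) (auto simp: bead_def)
  also have "\<dots> = (\<Sum>i<N. 2 * bead p i + 1) + (\<Sum>i<N. 2 * int i + 1)"
    by (rule sum.distrib)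
  also have "(\<Sum>i<N. 2 * int i + 1) = (int N)\<^sup>2"
    by (induction N) (auto simp: power2_eq_square algebra_simps)
  finally show ?thesis using beads by simp
qed

text \<open>The shift by \<open>m + 1\<close> turns \<open>2 * x + 1\<close> into
  \<open>2 * w - s = (w\<^sup>2 - (w - s)\<^sup>2) / s\<close>, so the size telescopes along each residue class.\<close>

lemma core_size_eq_sum_squares:
  fixes m :: nat
  defines "s \<equiv> 2 * int m + 1"
  assumes p: "is_partition p"
    and closed: "\<And>w. w - int m - 1 \<in> beads p \<Longrightarrow> w - s - int m - 1 \<in> beads p"
  shows "2 * s * int (partition_size p)
    = (\<Sum>w | w - int m - 1 \<in> beads p \<and> w + s - int m - 1 \<notin> beads p. w\<^sup>2)
      - (\<Sum>w\<in>{- int m..int m}. w\<^sup>2)"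
proof -
  obtain N where N: "\<And>i. i \<ge> N \<Longrightarrow> p i = 0"
    using is_partition_eventually_zero[OF p] by blast
  \<comment> \<open>\<open>V\<close> is decomposed twice: as \<open>U\<close> with the full period
    \<open>I\<close> below it, and as the class maxima \<open>T\<close> with \<open>U\<close>
    lowered by \<open>s\<close>. Comparing sums of squares gives the telescoping.\<close>
  define W where "W = {w. w - int m - 1 \<in> beads p}"
  define T where "T = {w\<in>W. w + s \<notin> W}"
  define U where "U = {w\<in>W. int m + 1 - int N \<le> w}"
  define V where "V = {w\<in>W. - int m - int N \<le> w}"
  define I where "I = {- int m - int N..int m - int N}"
  have W: "w - s \<in> W" if "w \<in> W" for w
    using closed that unfolding W_def by simp
  have low: "w \<in> W" if "w \<le> int m - int N" for w
  proof -
    define i where "i = nat (int m - w)"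
    have i: "int i = int m - w" "i \<ge> N" using that unfolding i_def by auto
    have "bead p i = w - int m - 1" using N[OF i(2)] i(1) unfolding bead_def by simp
    then show ?thesis unfolding W_def beads_def by (metis mem_Collect_eq rangeI)
  qed
  obtain b where "\<And>x. x \<in> beads p \<Longrightarrow> x \<le> b"
    using beads_bounded_above[OF p] unfolding bdd_above_def by blast
  then have b: "w \<le> b + int m + 1" if "w \<in> W" for w
    using that unfolding W_def by fastforce
  have "V \<subseteq> {- int m - int N..b + int m + 1}" using b unfolding V_def by auto
  then have finV: "finite V" by (rule finite_subset) simp
  have V1: "V = U \<union> I" "U \<inter> I = {}"
    using low unfolding V_def U_def I_def by auto
  have V2: "V = T \<union> (\<lambda>w. w - s) ` U"
  proof (intro equalityI subsetI)
    fix w assume w: "w \<in> V"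
    show "w \<in> T \<union> (\<lambda>w. w - s) ` U"
    proof (cases "w + s \<in> W")
      case True
      then have "w + s \<in> U" using w unfolding U_def V_def s_def by auto
      then have "(w + s) - s \<in> (\<lambda>w. w - s) ` U" by blast
      then show ?thesis by simp
    qed (use w in \<open>auto simp: T_def V_def\<close>)
  next
    fix w assume "w \<in> T \<union> (\<lambda>w. w - s) ` U"
    then show "w \<in> V"
    proof
      assume w: "w \<in> T"
      then have "\<not> w + s \<le> int m - int N" using low unfolding T_def by blast
      then show ?thesis using w unfolding T_def V_def s_def by auto
    next
      assume "w \<in> (\<lambda>w. w - s) ` U"
      then show ?thesis using W unfolding U_def V_def s_def by fastforce
    qed
  qed
  have disj: "T \<inter> (\<lambda>w. w - s) ` U = {}" unfolding T_def U_def by auto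
  have fin: "finite U" "finite I" "finite T" "finite ((\<lambda>w. w - s) ` U)"
    using finV V1(1) V2 by (metis finite_Un)+
  have "(\<Sum>w\<in>V. w\<^sup>2) = (\<Sum>w\<in>U. w\<^sup>2) + (\<Sum>w\<in>I. w\<^sup>2)"
    unfolding V1(1) using fin V1(2) by (intro sum.union_disjoint) auto
  moreover have "(\<Sum>w\<in>V. w\<^sup>2) = (\<Sum>w\<in>T. w\<^sup>2) + (\<Sum>w\<in>(\<lambda>w. w - s) ` U. w\<^sup>2)"
    unfolding V2 using fin disj by (intro sum.union_disjoint) auto
  moreover have "(\<Sum>w\<in>(\<lambda>w. w - s) ` U. w\<^sup>2) = (\<Sum>w\<in>U. (w - s)\<^sup>2)"
    by (subst sum.reindex) (auto simp: inj_on_def)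
  ultimately have telescope:
    "(\<Sum>w\<in>U. w\<^sup>2) - (\<Sum>w\<in>U. (w - s)\<^sup>2) = (\<Sum>w\<in>T. w\<^sup>2) - (\<Sum>w\<in>I. w\<^sup>2)"
    by simp
  have beads: "(\<Sum>x\<in>{x\<in>beads p. - int N \<le> x}. 2 * x + 1) = (\<Sum>w\<in>U. 2 * w - s)"
    by (rule sum.reindex_bij_witness[where i = "\<lambda>w. w - int m - 1" and j = "\<lambda>x. x + int m + 1"])
      (auto simp: U_def W_def s_def)
  have size: "2 * int (partition_size p)
      = (\<Sum>x\<in>{x\<in>beads p. - int N \<le> x}. 2 * x + 1) + (int N)\<^sup>2"
    using partition_size_beads[OF p] N by blast
  have "2 * s * int (partition_size p) = s * (\<Sum>w\<in>U. 2 * w - s) + s * (int N)\<^sup>2"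
  proof -
    have size: "2 * int (partition_size p)
      = (\<Sum>x\<in>{x\<in>beads p. - int N \<le> x}. 2 * x + 1) + (int N)\<^sup>2"
    using partition_size_beads[OF p] N by blast
  have "2 * s * int (partition_size p) = s * (2 * int (partition_size p))" by simp
    then show ?thesis unfolding size beads distrib_left .
  qed
  also have "s * (\<Sum>w\<in>U. 2 * w - s) = (\<Sum>w\<in>U. w\<^sup>2 - (w - s)\<^sup>2)"
    unfolding sum_distrib_left by (intro sum.cong) (auto simp: power2_eq_square algebra_simps)
  also have "\<dots> = (\<Sum>w\<in>T. w\<^sup>2) - (\<Sum>w\<in>I. w\<^sup>2)"
    unfolding sum_subtractf telescope ..
  \<comment> \<open>Centring \<open>I\<close> at \<open>0\<close> kills the linear term and yields
    \<open>s\<close> times the square of \<open>N\<close>, which cancels the same term in the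
    size.\<close>
  also have "(\<Sum>w\<in>I. w\<^sup>2) = (\<Sum>e\<in>{- int m..int m}. (e - int N)\<^sup>2)"
    by (rule sum.reindex_bij_witness[where i = "\<lambda>w. w - int N" and j = "\<lambda>x. x + int N"])
      (auto simp: I_def)
  also have "\<dots> = (\<Sum>e\<in>{- int m..int m}. e\<^sup>2 + (int N)\<^sup>2 - 2 * int N * e)"
    by (intro sum.cong) (auto simp: power2_eq_square algebra_simps)
  also have "\<dots> = (\<Sum>e\<in>{- int m..int m}. e\<^sup>2) + s * (int N)\<^sup>2 - 2 * int N * (\<Sum>e\<in>{- int m..int m}. e)"
    by (simp add: sum.distrib sum_subtractf sum_distrib_left s_def)
  also have "(\<Sum>e\<in>{- int m..int m}. e) = 0"
  proof -
    have "(\<Sum>e\<in>{- int m..int m}. e) = (\<Sum>e\<in>{- int m..int m}. - e)"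
      by (rule sum.reindex_bij_witness[where i = uminus and j = uminus]) auto
    then show ?thesis unfolding sum_negf by simp
  qed
  finally show ?thesis unfolding T_def W_def by simp
qed

section \<open>Sums over lattice paths\<close>

text \<open>The values beyond \<open>m\<close> carry no information; fixing them to be \<open>0\<close> makes the set finite.\<close>

definition paths :: "nat \<Rightarrow> nat \<Rightarrow> (nat \<Rightarrow> nat) set" where
  "paths m n = {f. f 0 = 0 \<and> (\<forall>i j. i \<le> j \<and> j \<le> m \<longrightarrow> f i \<le> f j) \<and> f m \<le> n \<and> (\<forall>j>m. f j = 0)}"

lemma paths_0_left: "paths 0 n = {\<lambda>_. 0}"
  unfolding paths_def by (auto simp: fun_eq_iff) (metis gr0I)

lemma paths_0_right: "paths m 0 = {\<lambda>_. 0}"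
  unfolding paths_def by (auto simp: fun_eq_iff) (metis le_zero_eq linorder_not_less order_refl)

text \<open>Pascal's recursion: the last value is either at most \<open>n\<close> or equal to
  \<open>Suc n\<close>, and in the latter case it can be reset to the default
  \<open>0\<close>.\<close>

lemma paths_Suc_Suc:
  "paths (Suc m) (Suc n) = paths (Suc m) n \<union> (\<lambda>f. f(Suc m := Suc n)) ` paths m (Suc n)"
proof (intro set_eqI iffI)
  fix f assume f: "f \<in> paths (Suc m) (Suc n)"
  show "f \<in> paths (Suc m) n \<union> (\<lambda>f. f(Suc m := Suc n)) ` paths m (Suc n)"
  proof (cases "f (Suc m) \<le> n")
    case True
    then show ?thesis using f unfolding paths_def by simp
  next
    case False
    then have eq: "f (Suc m) = Suc n" using f unfolding paths_def by simp
    have "f(Suc m := 0) \<in> paths m (Suc n)"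
    proof -
      have "f m \<le> f (Suc m)" using f unfolding paths_def by simp
      then show ?thesis using f eq unfolding paths_def by auto
    qed
    moreover have "f = (f(Suc m := 0))(Suc m := Suc n)" using eq by auto
    ultimately show ?thesis by blast
  qed
next
  fix f assume "f \<in> paths (Suc m) n \<union> (\<lambda>f. f(Suc m := Suc n)) ` paths m (Suc n)"
  then show "f \<in> paths (Suc m) (Suc n)"
  proof
    assume "f \<in> paths (Suc m) n"
    then show ?thesis unfolding paths_def by auto
  next
    assume "f \<in> (\<lambda>f. f(Suc m := Suc n)) ` paths m (Suc n)"
    then obtain g where g: "g \<in> paths m (Suc n)" "f = g(Suc m := Suc n)" by blast
    have "g i \<le> Suc n" if "i \<le> m" for i
      using g(1) that unfolding paths_def by (auto intro: order_trans)
    then show ?thesis using g unfolding paths_def by (auto simp: le_Suc_eq)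
  qed
qed

lemma finite_paths: "finite (paths m n)"
proof (induction "m + n" arbitrary: m n)
  case 0
  then show ?case by (simp add: paths_0_left)
next
  case (Suc k)
  show ?case
    by (cases m; cases n) (use Suc in \<open>auto simp: paths_0_left paths_0_right paths_Suc_Suc\<close>)
qed

lemma sum_paths_Suc_Suc:
  fixes F :: "(nat \<Rightarrow> nat) \<Rightarrow> 'a::comm_monoid_add"
  shows "sum F (paths (Suc m) (Suc n))
    = sum F (paths (Suc m) n) + (\<Sum>f\<in>paths m (Suc n). F (f(Suc m := Suc n)))"
proof -
  have "inj_on (\<lambda>f. f(Suc m := Suc n)) (paths m (Suc n))"
  proof (rule inj_onI)
    fix f g assume fg: "f \<in> paths m (Suc n)" "g \<in> paths m (Suc n)"
      "f(Suc m := Suc n) = g(Suc m := Suc n)"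
    \<comment> \<open>Both are the default \<open>0\<close>, so overwriting there forgets
      nothing.\<close>
    then have "f (Suc m) = g (Suc m)" unfolding paths_def by simp
    then show "f = g" using fg(3) by (metis fun_upd_triv fun_upd_upd)
  qed
  moreover have "paths (Suc m) n \<inter> (\<lambda>f. f(Suc m := Suc n)) ` paths m (Suc n) = {}"
    unfolding paths_def by auto
  ultimately show ?thesis
    unfolding paths_Suc_Suc using finite_paths
    by (subst sum.union_disjoint) (auto simp: sum.reindex)
qed

lemma card_paths: "card (paths m n) = (m + n) choose m"
proof (induction "m + n" arbitrary: m n)
  case 0
  then show ?case by (simp add: paths_0_left)
next
  case (Suc k)
  show ?case
  proof (cases "m = 0 \<or> n = 0")
    case True
    then show ?thesis by (auto simp: paths_0_left paths_0_right)
  next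
    case False
    then obtain m' n' where mn: "m = Suc m'" "n = Suc n'" by (metis not0_implies_Suc)
    have "card (paths m n) = card (paths m n') + card (paths m' n)"
      using sum_paths_Suc_Suc[of "\<lambda>_. 1::nat" m' n'] unfolding mn by simp
    also have "\<dots> = ((m + n') choose m) + ((m' + n) choose m')"
      using Suc mn by simp
    also have "\<dots> = (m + n) choose m"
      unfolding mn by simp
    finally show ?thesis .
  qed
qed

section \<open>Averages over paths\<close>

text \<open>The two classes of the recursion have sizes in the ratio \<open>Suc n\<close> to
  \<open>Suc m\<close>, so averages need no binomial coefficients.\<close>

lemma card_paths_ratio:
  "Suc m * card (paths (Suc m) n) = Suc n * card (paths m (Suc n))"
  using Suc_times_binomial_add[of n m] Suc_times_binomial_add[of m n]
  by (simp add: card_paths del: binomial_Suc_Suc)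

text \<open>\<open>G\<close> is the conjectured average; \<open>step\<close> says that it is the
  weighted mean of the averages over the two classes of the recursion.\<close>

lemma paths_sum_induct:
  fixes F :: "nat \<Rightarrow> nat \<Rightarrow> real" and G :: "nat \<Rightarrow> nat \<Rightarrow> real"
  assumes G0: "\<And>n. G 0 n = 0" "\<And>m. G m 0 = (\<Sum>j=1..m. F j 0)"
    and step: "\<And>m n. real (Suc n) * G (Suc m) n + real (Suc m) * (G m (Suc n) + F (Suc m) (Suc n))
      = real (Suc m + Suc n) * G (Suc m) (Suc n)"
  shows "(\<Sum>f\<in>paths m n. \<Sum>j=1..m. F j (f j)) = card (paths m n) * G m n"
proof (induction "m + n" arbitrary: m n)
  case 0
  then show ?case by (simp add: paths_0_left G0)
next
  case (Suc k)
  show ?case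
  proof (cases "m = 0 \<or> n = 0")
    case True
    then show ?thesis by (auto simp: paths_0_left paths_0_right G0)
  next
    case False
    then obtain m' n' where mn: "m = Suc m'" "n = Suc n'" by (metis not0_implies_Suc)
    have c: "card (paths m n) = card (paths m n') + card (paths m' n)"
      using sum_paths_Suc_Suc[of "\<lambda>_. 1::nat" m' n'] unfolding mn by simp
    have "(\<Sum>f\<in>paths m n. \<Sum>j=1..m. F j (f j))
      = (\<Sum>f\<in>paths m n'. \<Sum>j=1..m. F j (f j)) + (\<Sum>f\<in>paths m' n. (\<Sum>j=1..m'. F j (f j)) + F m n)"
      unfolding mn sum_paths_Suc_Suc by (intro arg_cong2[of _ _ _ _ "(+)"] sum.cong) auto
    also have "\<dots> = card (paths m n') * G m n' + card (paths m' n) * (G m' n + F m n)"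
      using Suc(1)[of m n'] Suc(1)[of m' n] Suc(2) mn by (simp add: sum.distrib distrib_left del: sum.cl_ivl_Suc)
    finally have eq: "(\<Sum>f\<in>paths m n. \<Sum>j=1..m. F j (f j))
      = card (paths m n') * G m n' + card (paths m' n) * (G m' n + F m n)" .
    define x y where "x = real (card (paths m n'))" and "y = real (card (paths m' n))"
    have xy: "x * m = y * n"
      using card_paths_ratio[of m' n'] unfolding mn x_def y_def
      by (metis mult.commute of_nat_mult)
    have st: "n * G m n' + m * (G m' n + F m n) = (m + n) * G m n"
      using step[of n' m'] unfolding mn by simp
    \<comment> \<open>By \<open>xy\<close>, the classes have shares \<open>n\<close> and
      \<open>m\<close> of the total \<open>m + n\<close>; multiplying by \<open>m + n\<close> avoids
      division.\<close>
    have "(m + n) * (x * G m n' + y * (G m' n + F m n))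
       = (x + y) * (n * G m n' + m * (G m' n + F m n))"
    proof -
      have "(m + n) * x = (x + y) * n" "(m + n) * y = (x + y) * m"
        using xy by (simp_all add: algebra_simps)
      then show ?thesis by (metis (no_types, lifting) distrib_left mult.assoc)
    qed
    also have "\<dots> = (m + n) * ((x + y) * G m n)"
      unfolding st by simp
    finally have "x * G m n' + y * (G m' n + F m n) = (x + y) * G m n"
      using mn by simp
    then show ?thesis unfolding eq c x_def y_def by simp
  qed
qed

text \<open>The guessed average is a polynomial in \<open>m\<close> and \<open>n\<close>, so the
  weighted mean condition is a polynomial identity.\<close>

lemma sum_paths_square:
  "(\<Sum>f\<in>paths m n. \<Sum>j=1..m. (real (f j))\<^sup>2)
    = card (paths m n) * (real n * real m * (2 * real n + 1) / 6)"
proof (rule paths_sum_induct[where F = "\<lambda>j x. (real x)\<^sup>2"])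
  fix m n :: nat
  define a b where "a = real m" and "b = real n"
  show "real (Suc n) * (real n * real (Suc m) * (2 * real n + 1) / 6)
      + real (Suc m) * (real (Suc n) * real m * (2 * real (Suc n) + 1) / 6 + (real (Suc n))\<^sup>2)
    = real (Suc m + Suc n) * (real (Suc n) * real (Suc m) * (2 * real (Suc n) + 1) / 6)"
    unfolding of_nat_add of_nat_Suc a_def[symmetric] b_def[symmetric]
    by (simp add: field_simps power2_eq_square)
qed simp_all

text \<open>The same method; this average is the previous one with \<open>m\<close> and
  \<open>n\<close> exchanged.\<close>

lemma sum_paths_linear:
  "(\<Sum>f\<in>paths m n. \<Sum>j=1..m. real j * real (f j))
    = card (paths m n) * (real n * real m * (2 * real m + 1) / 6)"
proof (rule paths_sum_induct[where F = "\<lambda>j x. real j * real x"])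
  fix m n :: nat
  define a b where "a = real m" and "b = real n"
  show "real (Suc n) * (real n * real (Suc m) * (2 * real (Suc m) + 1) / 6)
      + real (Suc m) * (real (Suc n) * real m * (2 * real m + 1) / 6 + real (Suc m) * real (Suc n))
    = real (Suc m + Suc n) * (real (Suc n) * real (Suc m) * (2 * real (Suc m) + 1) / 6)"
    unfolding of_nat_add of_nat_Suc a_def[symmetric] b_def[symmetric]
    by (simp add: field_simps)
qed simp_all

lemma sum_squares_real:
  "(\<Sum>j=1..m. (real j)\<^sup>2) = real m * (real m + 1) * (2 * real m + 1) / 6"
proof (induction m)
  case (Suc m)
  have "(\<Sum>j=1..Suc m. (real j)\<^sup>2) = (\<Sum>j=1..m. (real j)\<^sup>2) + (real m + 1)\<^sup>2"
    by (simp add: add.commute)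
  also have "\<dots> = real m * (real m + 1) * (2 * real m + 1) / 6 + (real m + 1)\<^sup>2"
    unfolding Suc ..
  also have "\<dots> = real (Suc m) * (real (Suc m) + 1) * (2 * real (Suc m) + 1) / 6"
    unfolding of_nat_Suc by (simp add: field_simps power2_eq_square)
  finally show ?case .
qed simp

section \<open>Simultaneous cores as lattice paths\<close>

lemma sum_symmetric_interval:
  fixes g :: "int \<Rightarrow> 'a::comm_ring_1"
  assumes "\<And>j. g (- j) = g j"
  shows "(\<Sum>j\<in>{- int m..int m}. g j) = g 0 + 2 * (\<Sum>j=1..m. g (int j))"
proof (induction m)
  case 0
  then show ?case by simp
next
  case (Suc m)
  have "{- int (Suc m)..int (Suc m)} = insert (- int (Suc m)) (insert (int (Suc m)) {- int m..int m})"
    by auto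
  then show ?case using Suc assms[of "int (Suc m)"] by (simp add: algebra_simps)
qed

text \<open>Self-conjugacy forces opposite values at \<open>j\<close> and \<open>- j\<close>, so a
  path on \<open>0..m\<close> determines all residue classes.\<close>

definition odd_extension :: "(nat \<Rightarrow> nat) \<Rightarrow> int \<Rightarrow> int" where
  "odd_extension f j = (if 0 \<le> j then int (f (nat j)) else - int (f (nat (- j))))"

text \<open>\<open>encodes m t f p\<close>: in the class of \<open>- t * j\<close> modulo \<open>2 * m + 1\<close>, shifted by \<open>m + 1\<close>, the largest
  bead of \<open>p\<close> is the one with \<open>k = odd_extension f j\<close>.\<close>

definition encodes :: "nat \<Rightarrow> nat \<Rightarrow> (nat \<Rightarrow> nat) \<Rightarrow> (nat \<Rightarrow> nat) \<Rightarrow> bool" where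
  "encodes m t f p \<longleftrightarrow> (\<forall>j\<in>{- int m..int m}. \<forall>k.
     (2 * int m + 1) * k - int t * j - int m - 1 \<in> beads p \<longleftrightarrow> k \<le> odd_extension f j)"

lemma odd_extension_uminus:
  assumes "f 0 = 0"
  shows "odd_extension f (- j) = - odd_extension f j"
  using assms unfolding odd_extension_def by auto

section \<open>Coordinates on the integers from two coprime moduli\<close>

lemma coprime_representation:
  fixes m t :: nat and w :: int
  assumes "coprime (2 * m + 1) t"
  obtains j k where "j \<in> {- int m..int m}" "w = (2 * int m + 1) * k - int t * j"
proof -
  define s where "s = 2 * int m + 1"
  have "coprime s (int t)"
    using assms unfolding s_def coprime_int_iff[symmetric] by (simp add: add.commute)
  then obtain u v where uv: "u * s + v * int t = 1"
    using bezout_int[of s "int t"] by (metis coprime_imp_gcd_eq_1)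
  \<comment> \<open>By Bezout, \<open>v\<close> inverts \<open>t\<close> modulo \<open>s\<close>, so
    \<open>j\<close> must be congruent to \<open>- v * w\<close>; shifting by \<open>m\<close>
    before and after \<open>mod\<close> selects the symmetric residue.\<close>
  define j where "j = (int m - v * w) mod s - int m"
  have "s > 0" unfolding s_def by simp
  then have "j \<in> {- int m..int m}"
    using pos_mod_bound[of s "int m - v * w"] pos_mod_sign[of s "int m - v * w"]
    unfolding j_def s_def by auto
  moreover define q where "q = (int m - v * w) div s"
  have jq: "j = - v * w - s * q"
    unfolding j_def q_def using div_mult_mod_eq[of "int m - v * w" s] by (simp add: algebra_simps)
  have "s * (u * w - int t * q) - int t * j = (u * s + v * int t) * w"
    unfolding jq by (simp add: algebra_simps)
  ultimately show ?thesis using that[of j "u * w - int t * q"] uv unfolding s_def by simp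
qed

text \<open>\<open>s\<close> divides \<open>t * (j - j')\<close>, hence \<open>j - j'\<close>, whose
  absolute value is at most \<open>2 * m < s\<close>.\<close>

lemma coprime_representation_unique:
  fixes m t :: nat and j k j' k' :: int
  assumes "coprime (2 * m + 1) t" and "j \<in> {- int m..int m}" "j' \<in> {- int m..int m}"
    and eq: "(2 * int m + 1) * k - int t * j = (2 * int m + 1) * k' - int t * j'"
  shows "j = j'" "k = k'"
proof -
  define s where "s = 2 * int m + 1"
  have "coprime s (int t)"
    using assms(1) unfolding s_def coprime_int_iff[symmetric] by (simp add: add.commute)
  moreover have "int t * (j - j') = s * (k - k')"
    using eq unfolding s_def by (simp add: algebra_simps)
  then have "s dvd int t * (j - j')" by simp
  ultimately have "s dvd j - j'" using coprime_dvd_mult_right_iff by blast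
  moreover have "\<bar>j - j'\<bar> < s" using assms(2,3) unfolding s_def by auto
  ultimately show "j = j'" using zdvd_imp_le[of s "\<bar>j - j'\<bar>"] by fastforce
  then show "k = k'" using eq by simp
qed

text \<open>Searching upwards from \<open>a\<close> for the first failure reduces the integers to
  \<open>LEAST\<close> on the naturals.\<close>

lemma int_downset_obtain_max:
  fixes P :: "int \<Rightarrow> bool"
  assumes down: "\<And>k. P k \<Longrightarrow> P (k - 1)" and a: "P a" and b: "\<And>k. P k \<Longrightarrow> k \<le> b"
  obtains z where "\<And>k. P k \<longleftrightarrow> k \<le> z"
proof -
  have down': "P (k - int n)" if "P k" for k n
  proof (induction n)
    case (Suc n)
    have "k - int (Suc n) = (k - int n) - 1" by simp
    then show ?case using down[OF Suc] by (simp only:)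
  qed (use that in simp)
  define n where "n = (LEAST n. \<not> P (a + int n))"
  have "\<not> P (a + int (nat (b - a) + 1))" using b[of "a + int (nat (b - a) + 1)"] by auto
  then have n: "\<not> P (a + int n)" unfolding n_def by (rule LeastI)
  have "n > 0" using n a by (cases n) auto
  then have n1: "P (a + int n - 1)"
    using not_less_Least[of "n - 1" "\<lambda>n. \<not> P (a + int n)"] unfolding n_def[symmetric]
    by (simp add: of_nat_diff algebra_simps)
  have "P k \<longleftrightarrow> k \<le> a + int n - 1" for k
  proof
    assume "P k"
    show "k \<le> a + int n - 1"
    proof (rule ccontr)
      assume "\<not> k \<le> a + int n - 1"
      then have "a + int n = k - int (nat (k - a - int n))" by simp
      then show False using down'[OF \<open>P k\<close>] n by metis
    qed
  next
    assume "k \<le> a + int n - 1"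
    then have "k = (a + int n - 1) - int (nat (a + int n - 1 - k))" by simp
    then show "P k" using down'[OF n1] by metis
  qed
  then show ?thesis by (rule that)
qed

lemma mem_self_conjugate_cores_iff:
  assumes "s \<ge> 1" "t \<ge> 1"
  shows "p \<in> self_conjugate_cores s \<inter> self_conjugate_cores t \<longleftrightarrow>
    is_partition p \<and> balanced (beads p) \<and> (\<forall>x\<in>beads p. x - int s \<in> beads p \<and> x - int t \<in> beads p)"
proof (cases "is_partition p")
  case True
  then show ?thesis
    using cores_iff_beads[OF True] self_conjugate_iff_balanced[OF True] assms
    unfolding self_conjugate_cores_def by blast
next
  case False
  then show ?thesis unfolding self_conjugate_cores_def cores_def by blast
qed

section \<open>The correspondence between cores and paths\<close>

text \<open>Closure under \<open>s\<close> gives each class a maximum \<open>Z j\<close>, closure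
  under \<open>t\<close> makes \<open>Z\<close> increase, balance makes it odd, and wrapping around
  the residues bounds \<open>Z m\<close>.\<close>

lemma core_obtain_path:
  assumes p: "p \<in> self_conjugate_cores (2 * m + 1) \<inter> self_conjugate_cores t" and "t \<ge> 1"
  obtains f where "f \<in> paths m (t div 2)" "encodes m t f p"
proof -
  define s where "s = 2 * int m + 1"
  define P where "P j k \<longleftrightarrow> s * k - int t * j - int m - 1 \<in> beads p" for j k
  have core: "is_partition p" "balanced (beads p)"
    "\<And>x. x \<in> beads p \<Longrightarrow> x - s \<in> beads p" "\<And>x. x \<in> beads p \<Longrightarrow> x - int t \<in> beads p"
    using p mem_self_conjugate_cores_iff[of "2 * m + 1" t p] \<open>t \<ge> 1\<close> unfolding s_def
    by (auto simp: add.commute)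
  have down: "P j (k - 1)" if "P j k" for j k
    using core(3)[OF that[unfolded P_def]] unfolding P_def by (simp add: algebra_simps)
  have right: "P (j + 1) k" if "P j k" for j k
    using core(4)[OF that[unfolded P_def]] unfolding P_def by (simp add: algebra_simps)
  \<comment> \<open>In shifted coordinates \<open>x\<close> to \<open>- 1 - x\<close> is
    \<open>w\<close> to \<open>s - w\<close>, whence \<open>1 - k\<close>.\<close>
  have flip: "P (- j) k \<longleftrightarrow> \<not> P j (1 - k)" for j k
  proof -
    have "s * (1 - k) - int t * j - int m - 1 = - 1 - (s * k - int t * (- j) - int m - 1)"
      unfolding s_def by (simp add: algebra_simps)
    then show ?thesis using core(2) unfolding P_def balanced_def by metis
  qed
  obtain b where b: "\<And>x. x \<in> beads p \<Longrightarrow> x \<le> b"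
    using beads_bounded_above[OF core(1)] unfolding bdd_above_def by blast
  have bound: "k \<le> \<bar>b + int t * j + int m + 1\<bar>" if "P j k" for j k
  proof -
    have "s * k \<le> b + int t * j + int m + 1" using b[OF that[unfolded P_def]] by simp
    then have le: "s * k \<le> \<bar>b + int t * j + int m + 1\<bar>" by simp
    have "k \<le> s * k" if "k \<ge> 0" using that unfolding s_def by (simp add: algebra_simps)
    then show ?thesis using le by (cases "k \<ge> 0") auto
  qed
  have ex: "\<exists>z. \<forall>k. P j k \<longleftrightarrow> k \<le> z" for j
  proof -
    \<comment> \<open>\<open>1 - k\<close> exceeds the bound for class \<open>- j\<close>, so it is
      a non-bead there, and \<open>flip\<close> turns it into a bead of class
      \<open>j\<close>.\<close>
    define k where "k = - \<bar>b + int t * (- j) + int m + 1\<bar>"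
    have "\<not> P (- j) (1 - k)" using bound[of "- j" "1 - k"] unfolding k_def by auto
    then have "P j k" using flip[of "- j" k] by simp
    from int_downset_obtain_max[of "P j", OF down this bound] show ?thesis by metis
  qed
  then obtain Z where Z: "\<And>j k. P j k \<longleftrightarrow> k \<le> Z j" by metis
  have odd: "Z (- j) = - Z j" for j
    using flip[of j "Z (- j)"] flip[of j "- Z j"] unfolding Z by auto
  have Z0: "Z 0 = 0" using odd[of 0] by simp
  have "Z j \<le> Z (j + 1)" for j using right[of j "Z j"] unfolding Z by simp
  then have step: "Z (int i) \<le> Z (int (Suc i))" for i by (metis of_nat_Suc add.commute)
  have mono: "Z (int i) \<le> Z (int j)" if "i \<le> j" for i j
    using lift_Suc_mono_le[of "\<lambda>i. Z (int i)", OF step that] .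
  have nonneg: "0 \<le> Z (int i)" for i using mono[of 0 i] Z0 by simp
  \<comment> \<open>Column \<open>m + 1\<close> is column \<open>- m\<close> with \<open>k\<close>
    lowered by \<open>t\<close>; hence \<open>Z m - t \<le> Z (- m) = - Z m\<close>.\<close>
  have "P (int m + 1) (Z (int m))" by (rule right) (simp add: Z)
  moreover have "s * Z (int m) - int t * (int m + 1) = s * (Z (int m) - int t) - int t * (- int m)"
    unfolding s_def by (simp add: algebra_simps)
  ultimately have "P (- int m) (Z (int m) - int t)" unfolding P_def by simp
  then have Zm: "2 * Z (int m) \<le> int t" unfolding Z odd by simp
  define f where "f i = (if i \<le> m then nat (Z (int i)) else 0)" for i
  have f: "int (f i) = Z (int i)" if "i \<le> m" for i using nonneg that unfolding f_def by simp
  have "nat (Z (int m)) \<le> t div 2" using Zm by linarith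
  then have "f \<in> paths m (t div 2)"
    unfolding paths_def using mono Z0 by (auto simp: f_def nat_mono)
  moreover have "odd_extension f j = Z j" if "j \<in> {- int m..int m}" for j
    using f[of "nat j"] f[of "nat (- j)"] odd[of "- j"] that unfolding odd_extension_def by auto
  then have "encodes m t f p" using Z unfolding encodes_def P_def s_def by simp
  ultimately show ?thesis by (rule that)
qed

text \<open>The inverse construction: prescribe the class maxima, then recover the partition from
  the resulting balanced set.\<close>

lemma path_obtain_core:
  assumes co: "coprime (2 * m + 1) t" and "t \<ge> 1" and f: "f \<in> paths m (t div 2)"
  obtains p where "p \<in> self_conjugate_cores (2 * m + 1) \<inter> self_conjugate_cores t" "encodes m t f p"
proof -
  define s where "s = 2 * int m + 1"
  define J where "J = {- int m..int m}"
  define h where "h = odd_extension f"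
  define S where "S = {s * k - int t * j - int m - 1 | j k. j \<in> J \<and> k \<le> h j}"
  have f0: "f 0 = 0" and mono: "\<And>i j. i \<le> j \<Longrightarrow> j \<le> m \<Longrightarrow> f i \<le> f j" and fm: "f m \<le> t div 2"
    using f unfolding paths_def by auto
  have odd: "h (- j) = - h j" for j unfolding h_def using odd_extension_uminus[of f, OF f0] .
  have hm: "2 * h (int m) \<le> int t" using fm unfolding h_def odd_extension_def by simp
  \<comment> \<open>The case \<open>j = - 1\<close>, where the two halves of the odd extension meet,
    uses \<open>f 0 = 0\<close>.\<close>
  have step: "h j \<le> h (j + 1)" if "- int m \<le> j" "j < int m" for j
    using that mono[of "nat j" "nat (j + 1)"] mono[of "nat (- (j + 1))" "nat (- j)"] f0
    unfolding h_def odd_extension_def by (cases "j = - 1") auto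
  have upper: "h j \<le> int t" if "j \<in> J" for j
  proof -
    have "f i \<le> t" if "i \<le> m" for i
      using mono[OF that] fm div_le_dividend[of t 2] by simp
    from this[of "nat j"] show ?thesis
      using that unfolding h_def odd_extension_def J_def by (auto simp: nat_le_iff)
  qed
  have mem: "s * k - int t * j - int m - 1 \<in> S \<longleftrightarrow> k \<le> h j" if "j \<in> J" for j k
  proof
    assume "s * k - int t * j - int m - 1 \<in> S"
    then obtain j' k' where jk: "j' \<in> J" "k' \<le> h j'" "s * k - int t * j = s * k' - int t * j'"
      unfolding S_def by auto
    then have "j = j'" "k = k'"
      using coprime_representation_unique[OF co, of j j' k k'] that unfolding J_def s_def by auto
    then show "k \<le> h j" using jk by simp
  next
    assume "k \<le> h j"
    then show "s * k - int t * j - int m - 1 \<in> S" using that unfolding S_def by blast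
  qed
  have rep: "\<exists>j\<in>J. \<exists>k. x = s * k - int t * j - int m - 1" for x
  proof -
    obtain j k where "j \<in> J" "x + int m + 1 = s * k - int t * j"
      using coprime_representation[OF co, of "x + int m + 1"] unfolding J_def s_def by blast
    then show ?thesis by (intro bexI[of _ j] exI[of _ k]) auto
  qed
  have bal: "balanced S"
    unfolding balanced_def
  proof
    fix x
    obtain j k where jk: "j \<in> J" "x = s * k - int t * j - int m - 1" using rep by blast
    have "- j \<in> J" using jk unfolding J_def by auto
    moreover have "- 1 - x = s * (1 - k) - int t * (- j) - int m - 1"
      unfolding jk(2) s_def by (simp add: algebra_simps)
    ultimately have "- 1 - x \<in> S \<longleftrightarrow> 1 - k \<le> h (- j)" using mem by metis
    moreover have "x \<in> S \<longleftrightarrow> k \<le> h j" using mem jk by metis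
    ultimately show "x \<in> S \<longleftrightarrow> - 1 - x \<notin> S" unfolding odd by auto
  qed
  have "bdd_above S"
  proof (rule bdd_aboveI)
    fix x assume "x \<in> S"
    then obtain j k where jk: "j \<in> J" "x = s * k - int t * j - int m - 1" "k \<le> h j"
      unfolding S_def by blast
    have "s * k \<le> s * int t" using jk(3) upper[OF jk(1)] unfolding s_def by (intro mult_left_mono) auto
    moreover have "int t * (- j) \<le> int t * int m" using jk(1) unfolding J_def by (intro mult_left_mono) auto
    ultimately show "x \<le> s * int t + int t * int m" unfolding jk(2) by simp
  qed
  then obtain p where p: "is_partition p" "beads p = S"
    using balanced_obtain_partition[OF bal] by blast
  have "x - s \<in> S \<and> x - int t \<in> S" if x: "x \<in> S" for x
  proof -
    obtain j k where jk: "j \<in> J" "x = s * k - int t * j - int m - 1" "k \<le> h j"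
      using x unfolding S_def by blast
    have "x - s = s * (k - 1) - int t * j - int m - 1" unfolding jk(2) by (simp add: algebra_simps)
    then have "x - s \<in> S" using mem[OF jk(1), of "k - 1"] jk(3) by simp
    moreover have "x - int t \<in> S"
    \<comment> \<open>Subtracting \<open>t\<close> moves to class \<open>j + 1\<close>; from
      \<open>m\<close> it wraps to \<open>- m\<close>, where the bound \<open>hm\<close> is what is
      required.\<close>
    proof (cases "j = int m")
      case True
      have "- int m \<in> J" unfolding J_def by simp
      moreover have "k - int t \<le> h (- int m)" using jk(3) hm True unfolding odd by simp
      moreover have "x - int t = s * (k - int t) - int t * (- int m) - int m - 1"
        unfolding jk(2) True s_def by (simp add: algebra_simps)
      ultimately show ?thesis using mem by metis
    next
      case False
      then have "j + 1 \<in> J" "k \<le> h (j + 1)" using jk step[of j] unfolding J_def by auto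
      moreover have "x - int t = s * k - int t * (j + 1) - int m - 1"
        unfolding jk(2) by (simp add: algebra_simps)
      ultimately show ?thesis using mem by metis
    qed
    ultimately show ?thesis ..
  qed
  then have "p \<in> self_conjugate_cores (2 * m + 1) \<inter> self_conjugate_cores t"
    using mem_self_conjugate_cores_iff[of "2 * m + 1" t p] \<open>t \<ge> 1\<close> p bal unfolding s_def
    by (auto simp: add.commute)
  moreover have "encodes m t f p"
    using mem unfolding encodes_def p(2) J_def s_def h_def by blast
  ultimately show ?thesis by (rule that)
qed

lemma encodes_path_unique:
  assumes "f \<in> paths m n" "g \<in> paths m n" "encodes m t f p" "encodes m t g p"
  shows "f = g"
proof
  fix i
  show "f i = g i"
  proof (cases "i \<le> m")
    case True
    then have "k \<le> odd_extension f (int i) \<longleftrightarrow> k \<le> odd_extension g (int i)" for k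
      using assms(3,4) unfolding encodes_def by auto
    then have "odd_extension f (int i) = odd_extension g (int i)" by (metis order_antisym order_refl)
    then show ?thesis unfolding odd_extension_def by simp
  next
    case False
    then show ?thesis using assms(1,2) unfolding paths_def by simp
  qed
qed

text \<open>Every integer has coordinates \<open>j\<close> and \<open>k\<close>, so the encoding
  decides membership in the whole bead set.\<close>

lemma encodes_partition_unique:
  assumes co: "coprime (2 * m + 1) t" and "is_partition p" "is_partition q"
    and enc: "encodes m t f p" "encodes m t f q"
  shows "p = q"
proof (rule beads_inject[OF assms(2,3)], rule set_eqI)
  fix x
  obtain j k where "j \<in> {- int m..int m}" "x + int m + 1 = (2 * int m + 1) * k - int t * j"
    using coprime_representation[OF co, of "x + int m + 1"] by blast
  moreover from this have "x = (2 * int m + 1) * k - int t * j - int m - 1" by simp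
  ultimately show "x \<in> beads p \<longleftrightarrow> x \<in> beads q"
    using enc unfolding encodes_def by metis
qed

text \<open>The class maxima in \<open>core_size_eq_sum_squares\<close> are the numbers
  \<open>v j\<close>. As \<open>v\<close> is odd, \<open>j\<close> and \<open>- j\<close> contribute
  equally, which cancels the factor \<open>2\<close>.\<close>

lemma encodes_partition_size:
  assumes co: "coprime (2 * m + 1) t" and p: "is_partition p" and f: "f 0 = 0"
    and enc: "encodes m t f p"
  shows "(2 * int m + 1) * int (partition_size p)
    = (\<Sum>j=1..m. ((2 * int m + 1) * int (f j) - int t * int j)\<^sup>2 - (int j)\<^sup>2)"
proof -
  define s where "s = 2 * int m + 1"
  define J where "J = {- int m..int m}"
  define v where "v j = s * odd_extension f j - int t * j" for j
  have enc': "s * k - int t * j - int m - 1 \<in> beads p \<longleftrightarrow> k \<le> odd_extension f j" if "j \<in> J" for j k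
    using enc that unfolding encodes_def J_def s_def by blast
  have rep: "\<exists>j\<in>J. \<exists>k. w = s * k - int t * j" for w
    using coprime_representation[OF co, of w] unfolding J_def s_def by blast
  have closed: "w - s - int m - 1 \<in> beads p" if w: "w - int m - 1 \<in> beads p" for w
  proof -
    obtain j k where jk: "j \<in> J" "w = s * k - int t * j" using rep by blast
    have "w - s - int m - 1 = s * (k - 1) - int t * j - int m - 1"
      unfolding jk(2) by (simp add: algebra_simps)
    moreover have "k \<le> odd_extension f j" using enc'[OF jk(1), of k] w unfolding jk(2) by simp
    ultimately show ?thesis using enc'[OF jk(1), of "k - 1"] by simp
  qed
  have "{w. w - int m - 1 \<in> beads p \<and> w + s - int m - 1 \<notin> beads p} = v ` J"
  proof (intro set_eqI)
    fix w
    obtain j k where jk: "j \<in> J" "w = s * k - int t * j" using rep by blast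
    have "w + s - int m - 1 = s * (k + 1) - int t * j - int m - 1"
      unfolding jk(2) by (simp add: algebra_simps)
    then have "w + s - int m - 1 \<in> beads p \<longleftrightarrow> k + 1 \<le> odd_extension f j"
      using enc'[OF jk(1), of "k + 1"] by simp
    moreover have "w - int m - 1 \<in> beads p \<longleftrightarrow> k \<le> odd_extension f j"
      unfolding jk(2) using enc'[OF jk(1)] .
    ultimately have "w - int m - 1 \<in> beads p \<and> w + s - int m - 1 \<notin> beads p
        \<longleftrightarrow> k = odd_extension f j"
      by auto
    also have "\<dots> \<longleftrightarrow> w \<in> v ` J"
    proof
      assume "w \<in> v ` J"
      then obtain i where i: "i \<in> J" "s * k - int t * j = s * odd_extension f i - int t * i"
        unfolding v_def jk(2) by blast
      then show "k = odd_extension f j"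
        using coprime_representation_unique[OF co, of j i k "odd_extension f i"] jk(1)
        unfolding J_def s_def by auto
    qed (use jk in \<open>auto simp: v_def\<close>)
    finally show "w \<in> {w. w - int m - 1 \<in> beads p \<and> w + s - int m - 1 \<notin> beads p} \<longleftrightarrow> w \<in> v ` J"
      by simp
  qed
  moreover have "inj_on v J"
    using coprime_representation_unique(1)[OF co] unfolding v_def J_def s_def by (intro inj_onI) blast
  ultimately have "2 * s * int (partition_size p) = (\<Sum>j\<in>J. (v j)\<^sup>2) - (\<Sum>j\<in>J. j\<^sup>2)"
    using core_size_eq_sum_squares[OF p, of m] closed unfolding s_def[symmetric] J_def[symmetric]
    by (simp add: sum.reindex)
  also have "\<dots> = 2 * (\<Sum>j=1..m. (v (int j))\<^sup>2) - 2 * (\<Sum>j=1..m. (int j)\<^sup>2)"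
  proof -
    have "v 0 = 0" using f unfolding v_def odd_extension_def by simp
    moreover have "(v (- j))\<^sup>2 = (v j)\<^sup>2" for j
      unfolding v_def odd_extension_uminus[of f, OF f] by (simp add: power2_eq_square algebra_simps)
    ultimately show ?thesis
      unfolding J_def using sum_symmetric_interval[of "\<lambda>j. (v j)\<^sup>2" m]
        sum_symmetric_interval[of "\<lambda>j. j\<^sup>2" m] by simp
  qed
  finally have "s * int (partition_size p) = (\<Sum>j=1..m. (v (int j))\<^sup>2 - (int j)\<^sup>2)"
    by (simp add: sum_subtractf)
  then show ?thesis unfolding s_def v_def odd_extension_def by simp
qed

section \<open>The average size\<close>

lemma sum_sizes_over_paths:
  fixes m t :: nat
  defines "s \<equiv> 2 * real m + 1" and "n \<equiv> t div 2"
  shows "(\<Sum>f\<in>paths m n. \<Sum>j=1..m. (s * real (f j) - real t * real j)\<^sup>2 - (real j)\<^sup>2)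
    = card (paths m n) * (s * (s - 1) * (real t - 1) * (s + real t + 1) / 24)"
proof -
  define A M N T where "A = real (card (paths m n))" and "M = real m" and "N = real n" and "T = real t"
  have "(\<Sum>f\<in>paths m n. \<Sum>j=1..m. (s * real (f j) - real t * real j)\<^sup>2 - (real j)\<^sup>2)
    = (\<Sum>f\<in>paths m n. \<Sum>j=1..m. s\<^sup>2 * (real (f j))\<^sup>2 - 2 * s * T * (real j * real (f j))
        + (T\<^sup>2 - 1) * (real j)\<^sup>2)"
    unfolding T_def by (intro sum.cong) (auto simp: power2_eq_square algebra_simps)
  also have "\<dots> = s\<^sup>2 * (\<Sum>f\<in>paths m n. \<Sum>j=1..m. (real (f j))\<^sup>2)
      - 2 * s * T * (\<Sum>f\<in>paths m n. \<Sum>j=1..m. real j * real (f j))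
      + (T\<^sup>2 - 1) * (A * (\<Sum>j=1..m. (real j)\<^sup>2))"
    unfolding A_def sum.distrib sum_subtractf by (simp add: sum_distrib_left mult.left_commute)
  also have "\<dots> = A * (s\<^sup>2 * (N * M * (2 * N + 1) / 6) - 2 * s * T * (N * M * (2 * M + 1) / 6)
      + (T\<^sup>2 - 1) * (M * (M + 1) * (2 * M + 1) / 6))"
    unfolding sum_paths_square sum_paths_linear sum_squares_real A_def[symmetric] M_def N_def
    by (simp add: algebra_simps)
  also have "s\<^sup>2 * (N * M * (2 * N + 1) / 6) - 2 * s * T * (N * M * (2 * M + 1) / 6)
      + (T\<^sup>2 - 1) * (M * (M + 1) * (2 * M + 1) / 6) = s * (s - 1) * (T - 1) * (s + T + 1) / 24"
  \<comment> \<open>As \<open>2 * M + 1 = s\<close>, the rounding in \<open>N\<close> enters only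
    through \<open>N * (2 * N + 1) - 2 * T * N\<close>, which equals
    \<open>- T * (T - 1) / 2\<close> for both parities.\<close>
  proof (cases "even t")
    case True
    then have "T = 2 * N" unfolding T_def N_def n_def by (auto elim: evenE)
    then show ?thesis unfolding s_def M_def[symmetric] by (simp add: field_simps power2_eq_square)
  next
    case False
    then have "T = 2 * N + 1" unfolding T_def N_def n_def by (auto elim: oddE)
    then show ?thesis unfolding s_def M_def[symmetric] by (simp add: field_simps power2_eq_square)
  qed
  finally show ?thesis unfolding A_def T_def .
qed

text \<open>Sums over cores become sums over paths along the bijection \<open>g\<close>; the factor
  \<open>s\<close> and the number of paths then cancel.\<close>

lemma average_size_odd:
  fixes s t :: nat
  assumes "odd s" and "t \<ge> 1" and "coprime s t"
  shows "(\<Sum>p \<in> self_conjugate_cores s \<inter> self_conjugate_cores t. real (partition_size p))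
           / (\<Sum>p \<in> self_conjugate_cores s \<inter> self_conjugate_cores t. 1)
         = 1 / 24 * (real s - 1) * (real t - 1) * (real s + real t + 1)"
proof -
  obtain m where m: "s = 2 * m + 1" using \<open>odd s\<close> by (rule oddE)
  define X where "X = self_conjugate_cores s \<inter> self_conjugate_cores t"
  define L where "L = paths m (t div 2)"
  have co: "coprime (2 * m + 1) t" using assms(3) m by simp
  have "\<forall>f\<in>L. \<exists>p. p \<in> X \<and> encodes m t f p"
    using path_obtain_core[OF co assms(2)] unfolding L_def X_def m by metis
  then obtain g where g: "\<And>f. f \<in> L \<Longrightarrow> g f \<in> X" "\<And>f. f \<in> L \<Longrightarrow> encodes m t f (g f)"
    by metis
  have part: "is_partition p" if "p \<in> X" for p
    using that unfolding X_def self_conjugate_cores_def cores_def by blast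
  have "bij_betw g L X"
    unfolding bij_betw_def
  proof
    show "inj_on g L"
      using g(2) encodes_path_unique unfolding L_def by (intro inj_onI) metis
    have "p \<in> g ` L" if p: "p \<in> X" for p
    proof -
      obtain f where f: "f \<in> L" "encodes m t f p"
        using core_obtain_path[of p m t] p assms(2) unfolding X_def L_def m by blast
      then have "p = g f" using encodes_partition_unique[OF co part part] p g by blast
      then show ?thesis using f by blast
    qed
    then show "g ` L = X" using g(1) by blast
  qed
  then have sum: "(\<Sum>p\<in>X. F p) = (\<Sum>f\<in>L. F (g f))" for F :: "(nat \<Rightarrow> nat) \<Rightarrow> real"
    by (rule sum.reindex_bij_betw[symmetric])
  have s: "real s = 2 * real m + 1" unfolding m by simp
  have size: "real s * real (partition_size (g f))
      = (\<Sum>j=1..m. ((2 * real m + 1) * real (f j) - real t * real j)\<^sup>2 - (real j)\<^sup>2)"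
    if f: "f \<in> L" for f
  proof -
    have "f 0 = 0" using f unfolding L_def paths_def by blast
    then have "(2 * int m + 1) * int (partition_size (g f))
      = (\<Sum>j=1..m. ((2 * int m + 1) * int (f j) - int t * int j)\<^sup>2 - (int j)\<^sup>2)"
      using encodes_partition_size[OF co] part g f by blast
    from arg_cong[OF this, of real_of_int] show ?thesis unfolding s by simp
  qed
  define c where "c = (real s - 1) * (real t - 1) * (real s + real t + 1) / 24"
  have "real s * (\<Sum>p\<in>X. real (partition_size p))
      = card L * (real s * (real s - 1) * (real t - 1) * (real s + real t + 1) / 24)"
    unfolding sum sum_distrib_left using sum_sizes_over_paths[of m t] size
    unfolding L_def[symmetric] s by simp
  then have "real s * (\<Sum>p\<in>X. real (partition_size p)) = real s * (card L * c)"
    unfolding c_def by simp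
  then have "(\<Sum>p\<in>X. real (partition_size p)) = card L * c"
    using s by simp
  moreover have "real (card L) \<noteq> 0" unfolding L_def card_paths by simp
  moreover have "(\<Sum>p\<in>X. 1::real) = card L" unfolding sum by simp
  ultimately show ?thesis unfolding X_def[symmetric] c_def by simp
qed

theorem theorem1p2:
  fixes s t :: nat
  assumes "s \<ge> 1" and "t \<ge> 1" and "coprime s t"
  shows "(\<Sum>p \<in> self_conjugate_cores s \<inter> self_conjugate_cores t. real (partition_size p))
           / (\<Sum>p \<in> self_conjugate_cores s \<inter> self_conjugate_cores t. 1)
         = 1 / 24 * (real s - 1) * (real t - 1) * (real s + real t + 1)"
proof (cases "odd s")
  case True
  then show ?thesis using average_size_odd assms by blast
next
  case False
  \<comment> \<open>Coprime numbers are not both even, and the claim is symmetric in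
    \<open>s\<close> and \<open>t\<close>.\<close>
  then have "odd t" using assms(3) by (meson coprime_common_divisor odd_one)
  then have "(\<Sum>p \<in> self_conjugate_cores t \<inter> self_conjugate_cores s. real (partition_size p))
           / (\<Sum>p \<in> self_conjugate_cores t \<inter> self_conjugate_cores s. 1)
         = 1 / 24 * (real t - 1) * (real s - 1) * (real t + real s + 1)"
    using average_size_odd assms(1) coprime_commute assms(3) by blast
  then show ?thesis by (simp only: Int_commute mult_ac add.commute)
qed

end
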